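(* Let $N\ge 2$, $\mathcal V=\{1,\dots,N\}$, and let $f_i:\mathbb R^N\to\mathbb R$, $i\in\mathcal V$, be the objective functions of an $N$-player game in which player $i$ chooses $x_i\in\mathbb R$ to minimize $f_i(\mathbf x)$, $\mathbf x=[x_1,\dots,x_N]^T$. Suppose that: (i) each $f_i$ is twice-continuously differentiable; (ii) for each $i\in\mathcal V$ there is a constant $l_i>0$ with $\|\nabla_i f_i(\mathbf x)-\nabla_i f_i(\mathbf z)\|\le l_i\|\mathbf x-\mathbf z\|$ for all $\mathbf x,\mathbf z\in\mathbb R^N$; (iii) there is a constant $m>0$ with $(\mathbf x-\mathbf z)^T(\mathcal P(\mathbf x)-\mathcal P(\mathbf z))\ge m\|\mathbf x-\mathbf z\|^2$ for all $\mathbf x,\mathbf z\in\mathbb R^N$, where $\mathcal P(\mathbf x)=[\nabla_1f_1(\mathbf x),\dots,\nabla_Nf_N(\mathbf x)]^T$; (iv) $\mathcal G^1,\dots,\mathcal G^p$ are undirected connected graphs on the vertex set $\mathcal V$ without self-loops, $\mathcal G^q$ having $0$-$1$ adjacency matrix $[a_{ij}^q]$, and the communication graph at time $t$ is $\mathcal G^{\sigma(t)}$, where $\sigma:[0,\infty)\to\{1,\dots,p\}$ is a switching signal that is constant on each interval $[t_k,t_{k+1})$, $k=0,1,2,\dots$, with $t_0=0$, and there is a constant $\epsilon>0$ with $t_{k+1}-t_k\ge\epsilon$ for all $k$. Let the players update their actions $x_i$, estimates $y_{ij}$ and adaptive gains $c_{ij}$, $\bar c_{ij}$ (all real-valued,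 $i,j\in\mathcal V$) according to $$\dot x_i=-\nabla_i f_i(\mathbf y_i),$$ $$\dot y_{ij}=-\Big(\sum_{k=1}^N a_{ik}^{\sigma(t)}c_{ik}(y_{ij}-y_{kj})+a_{ij}^{\sigma(t)}\bar c_{ij}(y_{ij}-x_j)\Big),$$ $$\dot c_{ij}=a_{ij}^{\sigma(t)}(\mathbf y_i-\mathbf y_j)^T(\mathbf y_i-\mathbf y_j),$$ $$\dot{\bar c}_{ij}=a_{ij}^{\sigma(t)}(y_{ij}-x_j)^2,$$ where $\mathbf y_i=[y_{i1},\dots,y_{iN}]^T$, $\mathbf y=[\mathbf y_1^T,\dots,\mathbf y_N^T]^T$, and $c_{ij}(0)=c_{ji}(0)$ for all $i,j\in\mathcal V$. Let $\mathbf x^*$ be the Nash equilibrium of the game. Then: 1. the Nash equilibrium $\mathbf x^*$ is globally asymptotically stable; 2. the players' estimation error satisfies $\|\mathbf y-\mathbf 1_N\otimes\mathbf x\|\to 0$ as $t\to\infty$; 3. the adaptive control gains $c_{ij}$ and $\bar c_{ij}$, for all $i,j\in\mathcal V$, converge to some finite values.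
   Context: $\nabla_i f_i(\mathbf z)$ denotes the partial derivative $\partial f_i(\mathbf x)/\partial x_i$ evaluated at $\mathbf x=\mathbf z$. $\|\cdot\|$ is the Euclidean norm, $\mathbf 1_N$ is the $N$-dimensional column vector of ones, $\otimes$ is the Kronecker product (so $\mathbf 1_N\otimes\mathbf x$ stacks $N$ copies of $\mathbf x$). The adjacency matrix of $\mathcal G^q$ has $a_{ij}^q=1$ if $(j,i)$ is an edge of $\mathcal G^q$ and $a_{ij}^q=0$ otherwise; undirected means $a_{ij}^q=a_{ji}^q$; no self-loops means $a_{ii}^q=0$; connected means there is a path between any two vertices. The variable $y_{ij}$ is player $i$'s local estimate of $x_j$. An action profile $\mathbf x^*=(x_i^*,\mathbf x_{-i}^* )$ is a Nash equilibrium if $f_i(x_i^*,\mathbf x_{-i}^* )\le f_i(x_i,\mathbf x_{-i}^* )$ for all $x_i\in\mathbb R$ and $i\in\mathcal V$, where $\mathbf x_{-i}=[x_1,\dots,x_{i-1},x_{i+1},\dots,x_N]^T$. Under hypotheses (i)-(iii) the Nash equilibrium exists, is unique, and is the unique solution of $\mathcal P(\mathbf x)=\mathbf 0_N$, where $\mathbf 0_N$ is the $N$-dimensional zero vector.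
   Formalization: Global asymptotic stability is read as convergence of x to x* from all initial data, plus Lyapunov stability of the equilibria (x*, 1⊗x*, c, c̄) whose gains are all sufficiently large; with small gains stability fails (N=2, f_i=5x_i², unit gains). *)

theory Defs
  imports "HOL-Analysis.Analysis"
begin

text \<open>The player set is a finite type \<open>'n\<close>. A profile of actions is a vector in \<open>real ^ 'n\<close>; families
  indexed by two players (estimates, gains) have type \<open>real ^ 'n ^ 'n\<close>, with \<open>y $ i\<close> the estimate
  vector of player \<open>i\<close> and \<open>y $ i $ j\<close> player \<open>i\<close>'s estimate of the action of \<open>j\<close>. The norm of
  \<open>real ^ 'n ^ 'n\<close> is the Euclidean norm of the vector of all entries.\<close>

definition deviate :: "real ^ 'n \<Rightarrow> 'n \<Rightarrow> real \<Rightarrow> real ^ 'n" where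
  "deviate x i s = (\<chi> j. if j = i then s else x $ j)"

definition partial :: "'n \<Rightarrow> (real ^ 'n \<Rightarrow> real) \<Rightarrow> real ^ 'n \<Rightarrow> real" where
  "partial i g z = deriv (\<lambda>s. g (deviate z i s)) (z $ i)"

definition pseudo_gradient :: "('n \<Rightarrow> real ^ 'n \<Rightarrow> real) \<Rightarrow> real ^ 'n \<Rightarrow> real ^ 'n" where
  "pseudo_gradient f x = (\<chi> i. partial i (f i) x)"

definition nash_equilibrium :: "('n \<Rightarrow> real ^ 'n \<Rightarrow> real) \<Rightarrow> real ^ 'n \<Rightarrow> bool" where
  "nash_equilibrium f x \<longleftrightarrow> (\<forall>i s. f i x \<le> f i (deviate x i s))"

definition twice_continuously_differentiable :: "('a::real_normed_vector \<Rightarrow> real) \<Rightarrow> bool" where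
  "twice_continuously_differentiable g \<longleftrightarrow>
     (\<exists>(g' :: 'a \<Rightarrow> 'a \<Rightarrow>\<^sub>L real) (g'' :: 'a \<Rightarrow> 'a \<Rightarrow>\<^sub>L ('a \<Rightarrow>\<^sub>L real)).
        (\<forall>x. (g has_derivative blinfun_apply (g' x)) (at x)) \<and>
        (\<forall>x. (g' has_derivative blinfun_apply (g'' x)) (at x)) \<and>
        continuous_on UNIV g'')"

text \<open>A graph on the vertex type \<open>'n\<close> is given by its set of (directed) edges.\<close>

definition undirected_connected_loopfree :: "('n \<times> 'n) set \<Rightarrow> bool" where
  "undirected_connected_loopfree E \<longleftrightarrow> sym E \<and> irrefl E \<and> (\<forall>i j. (i, j) \<in> E\<^sup>*)"

definition adj :: "('n \<times> 'n) set \<Rightarrow> 'n \<Rightarrow> 'n \<Rightarrow> real" where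
  "adj E i j = (if (j, i) \<in> E then 1 else 0)"

definition switching_signal :: "nat \<Rightarrow> (nat \<Rightarrow> real) \<Rightarrow> (real \<Rightarrow> nat) \<Rightarrow> bool" where
  "switching_signal p \<tau> \<sigma> \<longleftrightarrow>
     (\<forall>t\<ge>0. \<sigma> t \<in> {1..p}) \<and> \<tau> 0 = 0 \<and>
     (\<exists>\<epsilon>>0. \<forall>k. \<tau> (Suc k) - \<tau> k \<ge> \<epsilon>) \<and>
     (\<forall>k. \<forall>t\<in>{\<tau> k..<\<tau> (Suc k)}. \<sigma> t = \<sigma> (\<tau> k))"

definition stacked :: "real ^ 'n \<Rightarrow> real ^ 'n ^ 'n" where
  "stacked x = (\<chi> i. x)"

text \<open>Since the right-hand side jumps at switching times, a solution is a continuous function that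
  satisfies the differential equations on every interval \<open>[\<tau> k, \<tau> (k + 1))\<close>, with the right
  derivative at \<open>\<tau> k\<close>. A state is a tuple of actions, estimates, gains \<open>c\<close> and gains \<open>d\<close> (the
  gains that act on \<open>y $ i $ j - x $ j\<close>).\<close>

type_synonym 'n state = "(real ^ 'n) \<times> (real ^ 'n ^ 'n) \<times> (real ^ 'n ^ 'n) \<times> (real ^ 'n ^ 'n)"

definition closed_loop_solutions ::
  "('n::finite \<Rightarrow> real ^ 'n \<Rightarrow> real) \<Rightarrow> (nat \<Rightarrow> ('n \<times> 'n) set) \<Rightarrow> (nat \<Rightarrow> real) \<Rightarrow> (real \<Rightarrow> nat)
     \<Rightarrow> (real \<Rightarrow> 'n state) set" where
  "closed_loop_solutions f G \<tau> \<sigma> = {\<lambda>t. (x t, y t, c t, d t) | x y c d.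
     continuous_on {0..} x \<and> continuous_on {0..} y \<and>
     continuous_on {0..} c \<and> continuous_on {0..} d \<and>
     (\<forall>i j. c 0 $ i $ j = c 0 $ j $ i) \<and>
     (\<forall>k. \<forall>t\<in>{\<tau> k..<\<tau> (Suc k)}. \<forall>i j.
        ((\<lambda>s. x s $ i) has_real_derivative - partial i (f i) (y t $ i))
           (at t within {\<tau> k..<\<tau> (Suc k)}) \<and>
        ((\<lambda>s. y s $ i $ j) has_real_derivative
             - ((\<Sum>l\<in>UNIV. adj (G (\<sigma> t)) i l * c t $ i $ l * (y t $ i $ j - y t $ l $ j))
                + adj (G (\<sigma> t)) i j * d t $ i $ j * (y t $ i $ j - x t $ j)))
           (at t within {\<tau> k..<\<tau> (Suc k)}) \<and>
        ((\<lambda>s. c s $ i $ j) has_real_derivative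
             adj (G (\<sigma> t)) i j * ((y t $ i - y t $ j) \<bullet> (y t $ i - y t $ j)))
           (at t within {\<tau> k..<\<tau> (Suc k)}) \<and>
        ((\<lambda>s. d s $ i $ j) has_real_derivative
             adj (G (\<sigma> t)) i j * (y t $ i $ j - x t $ j)\<^sup>2)
           (at t within {\<tau> k..<\<tau> (Suc k)}))}"

definition lyapunov_stable :: "(real \<Rightarrow> 'a::metric_space) set \<Rightarrow> 'a \<Rightarrow> bool" where
  "lyapunov_stable S e \<longleftrightarrow>
     (\<forall>\<epsilon>>0. \<exists>\<delta>>0. \<forall>z\<in>S. dist (z 0) e < \<delta> \<longrightarrow> (\<forall>t\<ge>0. dist (z t) e < \<epsilon>))"

text \<open>An action profile is not by itself a point of the closed-loop state space: the states in which
  all actions and estimates agree with \<open>xs\<close> are equilibria for every value of the gains. Those with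
  small gains can be unstable (for two players with cost \<open>5 * (x $ i)\<^sup>2\<close> each and all gains equal to 1,
  the linearization has eigenvalues with positive real part), so Lyapunov stability is required at all
  the equilibria with sufficiently large gains, whereas attraction is required from every initial
  state, including arbitrary initial gains.\<close>

definition nash_globally_asymptotically_stable ::
  "(real \<Rightarrow> 'n::finite state) set \<Rightarrow> real ^ 'n \<Rightarrow> bool" where
  "nash_globally_asymptotically_stable S xs \<longleftrightarrow>
     (\<exists>\<kappa>. \<forall>C D. (\<forall>i j. C $ i $ j = C $ j $ i \<and> \<kappa> \<le> C $ i $ j \<and> \<kappa> \<le> D $ i $ j) \<longrightarrow>
        lyapunov_stable S (xs, stacked xs, C, D)) \<and>
     (\<forall>z\<in>S. ((\<lambda>t. fst (z t)) \<longlongrightarrow> xs) at_top)"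

end

theory Submission
  imports Defs
begin

text \<open>
  Write \<open>e = y - stacked x\<close> for the estimation error, \<open>energy\<close> for half of
  \<open>(norm (x - xs))\<^sup>2 + (norm e)\<^sup>2\<close>, and add to it the distance of the gains from reference gains
  \<open>C\<close>, \<open>D\<close>:
  \<open>lyapunov C D = energy + (norm (c - C))\<^sup>2 / 4 + (norm (d - D))\<^sup>2 / 2\<close>.
  The coupling dissipates the error at a rate that is linear in the gains \<open>c\<close>, \<open>d\<close>
  (\<open>inner_coupling\<close>), and the adaptation laws are chosen so that the derivative of the gain terms
  replaces \<open>c\<close>, \<open>d\<close> in this rate by \<open>C\<close>, \<open>D\<close> (\<open>lyapunov_derivative\<close>). What is left is
  a competition between the game and a diffusion with constant gains. By strong
  monotonicity the game contributes \<open>- m * (norm (x - xs))\<^sup>2\<close>, spoiled by terms of order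
  \<open>norm (x - xs) * norm e\<close> and \<open>(norm e)\<^sup>2\<close> because the players use estimates
  (\<open>game_dissipation\<close>). On a connected graph the diffusion is at least a constant times
  \<open>(norm e)\<^sup>2\<close>: a vanishing diffusion forces all players to hold the same estimates, and a
  neighbour of player \<open>j\<close> knows the action of \<open>j\<close> (\<open>diffusion_ones_eq_0\<close>). Since only
  finitely many graphs occur, the constant is uniform, and for all sufficiently large \<open>C\<close>, \<open>D\<close> the
  derivative is at most \<open>- m * energy\<close>, whichever graph is active
  (\<open>large_gains_dissipative\<close>). As \<open>lyapunov C D\<close> does not involve the graph, it is a common
  Lyapunov function for all switching signals.

  Stability at an equilibrium with large gains \<open>C\<close>, \<open>D\<close> follows because \<open>lyapunov C D\<close> is comparable
  with the squared distance to that equilibrium and does not increase. For convergence, fix any large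
  \<open>C\<close>, \<open>D\<close>. The gains are nondecreasing, and bounded since \<open>lyapunov C D\<close> is, so they converge.
  As \<open>lyapunov C D\<close> converges too, so does \<open>energy\<close>. A positive limit would make
  \<open>lyapunov C D\<close> decrease at a rate bounded away from zero and become negative, hence
  \<open>energy\<close> tends to zero (\<open>energy_tendsto_0\<close>).
\<close>

section \<open>Functions differentiable off the switching times\<close>

text \<open>The fundamental theorem of calculus tolerates finitely many exceptional points. There the
  integrand is given the value \<open>K\<close>, which keeps the upper bound.\<close>
lemma increment_le_of_derivative_le:
  fixes g g' :: "real \<Rightarrow> real"
  assumes "finite S" "a \<le> b" "continuous_on {a..b} g"
    and deriv: "\<And>t. t \<in> {a<..<b} - S \<Longrightarrow> (g has_real_derivative g' t) (at t)"
    and le: "\<And>t. t \<in> {a<..<b} - S \<Longrightarrow> g' t \<le> K"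
  shows "g b - g a \<le> K * (b - a)"
proof -
  define h where "h t = (if t \<in> {a<..<b} - S then g' t else K)" for t
  have "(h has_integral g b - g a) {a..b}"
  proof (rule fundamental_theorem_of_calculus_interior_strong[OF assms(1-2) _ assms(3)])
    fix t assume "t \<in> {a<..<b} - S"
    then show "(g has_vector_derivative h t) (at t)"
      using deriv[of t] by (simp add: h_def has_real_derivative_iff_has_vector_derivative)
  qed
  moreover have "((\<lambda>_. K) has_integral K * (b - a)) {a..b}"
    using has_integral_const_real[of K a b] assms(2) by (simp add: mult.commute)
  ultimately show ?thesis
    by (rule has_integral_le) (auto simp: h_def le)
qed

lemma switching_times_ge:
  assumes "\<And>k. \<tau> (Suc k) - \<tau> k \<ge> \<epsilon>" "\<tau> 0 = (0::real)"
  shows "real k * \<epsilon> \<le> \<tau> k"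
proof (induction k)
  case (Suc k)
  then show ?case using assms(1)[of k] by (simp add: algebra_simps)
qed (simp add: assms)

lemma switching_times_unbounded:
  assumes "switching_signal p \<tau> \<sigma>"
  shows "\<exists>n. \<forall>k\<ge>n. b < \<tau> k"
proof -
  obtain \<epsilon> where e: "\<epsilon> > 0" "\<And>k. \<tau> (Suc k) - \<tau> k \<ge> \<epsilon>" and 0: "\<tau> 0 = 0"
    using assms unfolding switching_signal_def by blast
  obtain n where n: "b < real n * \<epsilon>"
    using reals_Archimedean3[OF e(1)] by blast
  have "b < \<tau> k" if "k \<ge> n" for k
  proof -
    have "real n * \<epsilon> \<le> real k * \<epsilon>" using that e(1) by simp
    with n switching_times_ge[of \<epsilon> \<tau> k, OF e(2) 0] show ?thesis by linarith
  qed
  then show ?thesis by blast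
qed

lemma between_switching_times:
  assumes "switching_signal p \<tau> \<sigma>" "t \<ge> 0" "t \<notin> range \<tau>"
  obtains k where "t \<in> {\<tau> k<..<\<tau> (Suc k)}"
proof -
  obtain n where "t < \<tau> n"
    using switching_times_unbounded[OF assms(1)] by blast
  moreover have "\<tau> 0 < t"
    using assms unfolding switching_signal_def by (metis order_le_less rangeI)
  ultimately have "\<exists>k. \<tau> k < t \<and> t < \<tau> (Suc k)"
  proof (induction n)
    case (Suc n)
    then show ?case using assms(3) by (metis linorder_neqE rangeI)
  qed simp
  with that show thesis by auto
qed

text \<open>The dwell time makes the switching times in a bounded interval finite in number, so they are
  harmless exceptional points.\<close>
lemma increment_le_between_switches:
  fixes g g' :: "real \<Rightarrow> real"
  assumes "switching_signal p \<tau> \<sigma>" "0 \<le> a" "a \<le> b" "continuous_on {0..} g"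
    and "\<And>t. 0 < t \<Longrightarrow> t \<notin> range \<tau> \<Longrightarrow> (g has_real_derivative g' t) (at t)"
    and "\<And>t. a < t \<Longrightarrow> t \<notin> range \<tau> \<Longrightarrow> g' t \<le> K"
  shows "g b - g a \<le> K * (b - a)"
proof (rule increment_le_of_derivative_le)
  obtain n where n: "\<forall>k\<ge>n. b < \<tau> k"
    using switching_times_unbounded[OF assms(1)] by blast
  have "range \<tau> \<inter> {..b} \<subseteq> \<tau> ` {..<n}"
    using n by (force simp: not_less[symmetric])
  then show "finite (range \<tau> \<inter> {..b})"
    by (rule finite_subset) simp
  show "continuous_on {a..b} g"
    using assms(2,4) by (auto intro: continuous_on_subset)
  show "(g has_real_derivative g' t) (at t)" if "t \<in> {a<..<b} - range \<tau> \<inter> {..b}" for t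
    using assms(2,5) that by auto
  show "g' t \<le> K" if "t \<in> {a<..<b} - range \<tau> \<inter> {..b}" for t
    using assms(6) that by auto
qed (rule assms(3))

lemma antitone_bounded_below_tendsto:
  fixes g :: "real \<Rightarrow> real"
  assumes anti: "\<And>s t. 0 \<le> s \<Longrightarrow> s \<le> t \<Longrightarrow> g t \<le> g s" and bound: "\<And>t. 0 \<le> t \<Longrightarrow> B \<le> g t"
  shows "\<exists>l. (g \<longlongrightarrow> l) at_top"
proof -
  have bdd: "bdd_below (g ` {0..})" using bound by (auto intro!: bdd_belowI)
  have "(g \<longlongrightarrow> Inf (g ` {0..})) at_top"
  proof (rule order_tendstoI)
    fix l assume "l < Inf (g ` {0..})"
    then have l: "l < g t" if "t \<ge> 0" for t
      using cInf_lower[OF _ bdd, of "g t"] that by fastforce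
    show "\<forall>\<^sub>F t in at_top. l < g t"
      using eventually_ge_at_top[of "0::real"] by eventually_elim (rule l)
  next
    fix u assume "Inf (g ` {0..}) < u"
    then obtain s where s: "s \<ge> 0" "g s < u"
      using cInf_lessD[of "g ` {0..}" u] by auto
    show "\<forall>\<^sub>F t in at_top. g t < u"
      using eventually_ge_at_top[of s] by eventually_elim (use anti s in force)
  qed
  then show ?thesis by blast
qed

section \<open>Norms of profiles and families\<close>

lemma norm_sq_vec: "(norm (v :: real ^ 'n))\<^sup>2 = (\<Sum>i\<in>UNIV. (v $ i)\<^sup>2)"
  unfolding power2_norm_eq_inner inner_vec_def by (simp add: power2_eq_square)

lemma norm_sq_matrix: "(norm (M :: real ^ 'n ^ 'm))\<^sup>2 = (\<Sum>i\<in>UNIV. (norm (M $ i))\<^sup>2)"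
  unfolding power2_norm_eq_inner inner_vec_def[of M] ..

lemma has_real_derivative_norm_sq_vec:
  assumes "\<And>i. ((\<lambda>s. v s $ i) has_real_derivative v' $ i) (at t)"
  shows "((\<lambda>s. (norm (v s :: real ^ 'n))\<^sup>2) has_real_derivative 2 * (v t \<bullet> v')) (at t)"
  unfolding norm_sq_vec inner_vec_def
  by (auto intro!: derivative_eq_intros assms simp: sum_distrib_left mult_ac)

lemma has_real_derivative_norm_sq_matrix:
  assumes "\<And>i j. ((\<lambda>s. M s $ i $ j) has_real_derivative M' $ i $ j) (at t)"
  shows "((\<lambda>s. (norm (M s :: real ^ 'n ^ 'm))\<^sup>2) has_real_derivative 2 * (M t \<bullet> M')) (at t)"
proof -
  have "((\<lambda>s. (norm (M s $ i))\<^sup>2) has_real_derivative 2 * (M t $ i \<bullet> M' $ i)) (at t)" for i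
    by (rule has_real_derivative_norm_sq_vec) (rule assms)
  then have "((\<lambda>s. \<Sum>i\<in>UNIV. (norm (M s $ i))\<^sup>2)
      has_real_derivative (\<Sum>i\<in>UNIV. 2 * (M t $ i \<bullet> M' $ i))) (at t)"
    by (rule DERIV_sum)
  then show ?thesis
    unfolding norm_sq_matrix inner_vec_def[of "M t"] sum_distrib_left .
qed

text \<open>A crude bound, sufficient to turn boundedness of the Lyapunov function into boundedness of each
  gain.\<close>
lemma entry_le_norm_sq: "M $ i $ j \<le> (norm (M :: real ^ 'a ^ 'b))\<^sup>2 + 1"
proof -
  have "M $ i $ j \<le> norm (M $ i)" using component_le_norm_cart[of "M $ i" j] by linarith
  also have "\<dots> \<le> norm M" by (rule Finite_Cartesian_Product.norm_nth_le)
  also have "\<dots> \<le> (norm M)\<^sup>2 + 1"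
    using zero_le_power2[of "norm M - 1/2"] by (simp add: power2_eq_square algebra_simps)
  finally show ?thesis .
qed

lemma stacked_diff: "stacked x - stacked z = stacked (x - z)"
  by (simp add: stacked_def vec_eq_iff)

lemma norm_sq_stacked: "(norm (stacked x :: real ^ 'n ^ 'n))\<^sup>2 = real CARD('n) * (norm x)\<^sup>2"
  by (simp add: norm_sq_matrix stacked_def)

lemma norm_stacked_le: "norm (stacked x :: real ^ 'n ^ 'n) \<le> real CARD('n) * norm x"
proof (rule power2_le_imp_le)
  have "1 \<le> real CARD('n)" by (simp add: Suc_leI)
  then have "real CARD('n) * (norm x)\<^sup>2 \<le> real CARD('n) * (real CARD('n) * (norm x)\<^sup>2)"
    using mult_right_mono[of 1 "real CARD('n)" "(norm x)\<^sup>2"] by (intro mult_left_mono) auto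
  then show "(norm (stacked x :: real ^ 'n ^ 'n))\<^sup>2 \<le> (real CARD('n) * norm x)\<^sup>2"
    unfolding norm_sq_stacked by (simp add: power2_eq_square mult_ac)
qed simp

section \<open>Dissipation by one communication graph\<close>

text \<open>The adaptation laws and the estimate dynamics depend on the estimates only through the error
  \<open>e = y - stacked x\<close>, since differences of two estimates of the same action equal differences of
  their errors.\<close>
definition c_rate :: "('n \<times> 'n) set \<Rightarrow> real ^ 'n ^ 'n \<Rightarrow> real ^ 'n ^ 'n" where
  "c_rate E e = (\<chi> i j. adj E i j * ((e $ i - e $ j) \<bullet> (e $ i - e $ j)))"

definition d_rate :: "('n \<times> 'n) set \<Rightarrow> real ^ 'n ^ 'n \<Rightarrow> real ^ 'n ^ 'n" where
  "d_rate E e = (\<chi> i j. adj E i j * (e $ i $ j)\<^sup>2)"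

definition coupling ::
    "('n::finite \<times> 'n) set \<Rightarrow> real ^ 'n ^ 'n \<Rightarrow> real ^ 'n ^ 'n \<Rightarrow> real ^ 'n ^ 'n \<Rightarrow> real ^ 'n ^ 'n" where
  "coupling E c d e = (\<chi> i j.
     (\<Sum>l\<in>UNIV. adj E i l * c $ i $ l * (e $ i $ j - e $ l $ j)) + adj E i j * d $ i $ j * e $ i $ j)"

text \<open>The dissipation rate of \<open>(norm e)\<^sup>2 / 2\<close> under the coupling. It is linear in the gains, with the
  adaptation rates as coefficients; this duality lets the adaptation laws exchange the actual
  gains for constant ones. The factor one half compensates that the sum counts every edge in both
  directions.\<close>
definition diffusion ::
    "('n::finite \<times> 'n) set \<Rightarrow> real ^ 'n ^ 'n \<Rightarrow> real ^ 'n ^ 'n \<Rightarrow> real ^ 'n ^ 'n \<Rightarrow> real" where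
  "diffusion E c d e = c \<bullet> c_rate E e / 2 + d \<bullet> d_rate E e"

lemma adj_nonneg: "adj E i j \<ge> 0"
  by (simp add: adj_def)

lemma adj_sym: "sym E \<Longrightarrow> adj E i j = adj E j i"
  by (auto simp: adj_def dest: symD)

lemma c_rate_nonneg: "c_rate E e $ i $ j \<ge> 0"
  by (simp add: c_rate_def adj_nonneg)

lemma d_rate_nonneg: "d_rate E e $ i $ j \<ge> 0"
  by (simp add: d_rate_def adj_nonneg)

lemma diffusion_diff: "diffusion E (c - C) (d - D) e = diffusion E c d e - diffusion E C D e"
  by (simp add: diffusion_def inner_diff_left diff_divide_distrib)

text \<open>Summation by parts on a weighted graph: average the sum with its copy in which the two
  endpoints of each edge are exchanged.\<close>
lemma sum_symmetric_weight:
  fixes v :: "'n::finite \<Rightarrow> 'a::real_inner"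
  assumes "\<And>i k. w i k = w k i"
  shows "(\<Sum>i\<in>UNIV. \<Sum>k\<in>UNIV. w i k * (v i \<bullet> (v i - v k)))
       = (\<Sum>i\<in>UNIV. \<Sum>k\<in>UNIV. w i k * ((v i - v k) \<bullet> (v i - v k))) / 2" (is "?S = ?T / 2")
proof -
  have "?S = (\<Sum>i\<in>UNIV. \<Sum>k\<in>UNIV. w i k * (v k \<bullet> (v k - v i)))"
    by (subst sum.swap) (simp add: assms)
  then have "?S + ?S = (\<Sum>i\<in>UNIV. \<Sum>k\<in>UNIV. w i k * (v i \<bullet> (v i - v k)) + w i k * (v k \<bullet> (v k - v i)))"
    by (simp add: sum.distrib)
  also have "\<dots> = ?T"
    by (intro sum.cong refl)
      (simp add: inner_diff_left inner_diff_right inner_commute distrib_left[symmetric])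
  finally show ?thesis by simp
qed

lemma inner_coupling:
  assumes "sym E" "\<And>i j. c $ i $ j = c $ j $ i"
  shows "e \<bullet> coupling E c d e = diffusion E c d e"
proof -
  have "e \<bullet> coupling E c d e
      = (\<Sum>i\<in>UNIV. \<Sum>j\<in>UNIV. \<Sum>l\<in>UNIV. adj E i l * c $ i $ l * (e $ i $ j * (e $ i $ j - e $ l $ j)))
        + d \<bullet> d_rate E e"
    by (simp add: inner_vec_def coupling_def d_rate_def distrib_left sum.distrib sum_distrib_left
        power2_eq_square mult_ac)
  also have "(\<Sum>i\<in>UNIV. \<Sum>j\<in>UNIV. \<Sum>l\<in>UNIV. adj E i l * c $ i $ l * (e $ i $ j * (e $ i $ j - e $ l $ j)))
      = (\<Sum>i\<in>UNIV. \<Sum>l\<in>UNIV. adj E i l * c $ i $ l * (e $ i \<bullet> (e $ i - e $ l)))"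
    by (rule sum.cong[OF refl], subst sum.swap) (simp add: inner_vec_def sum_distrib_left)
  also have "\<dots> = c \<bullet> c_rate E e / 2"
    using sum_symmetric_weight[of "\<lambda>i l. adj E i l * c $ i $ l" "\<lambda>i. e $ i"] assms
    by (simp add: adj_sym inner_vec_def[of c] inner_vec_def[of "c $ _"] c_rate_def mult_ac)
  finally show ?thesis by (simp add: diffusion_def)
qed

definition ones :: "real ^ 'n ^ 'n" where
  "ones = (\<chi> i j. 1)"

lemma inner_ge_ones:
  assumes "\<And>i j. \<kappa> \<le> C $ i $ j" "\<And>i j. M $ i $ j \<ge> 0"
  shows "C \<bullet> M \<ge> \<kappa> * (ones \<bullet> (M :: real ^ 'n ^ 'n))"
  by (simp add: inner_vec_def ones_def sum_distrib_left) (intro sum_mono mult_right_mono assms)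

lemma diffusion_ge_ones:
  assumes "\<And>i j. \<kappa> \<le> C $ i $ j" "\<And>i j. \<kappa> \<le> D $ i $ j"
  shows "\<kappa> * diffusion E ones ones e \<le> diffusion E C D e"
proof -
  have "\<kappa> * (ones \<bullet> c_rate E e) \<le> C \<bullet> c_rate E e" "\<kappa> * (ones \<bullet> d_rate E e) \<le> D \<bullet> d_rate E e"
    by (intro inner_ge_ones assms c_rate_nonneg d_rate_nonneg)+
  then show ?thesis by (simp add: diffusion_def distrib_left)
qed

text \<open>The two parts of the diffusion play different roles. The first vanishes only if neighbours, hence
  by connectedness all players, hold the same errors. The second vanishes only if every neighbour of
  \<open>j\<close> has error zero about \<open>j\<close>, and \<open>j\<close> has a neighbour because there is a second player.\<close>
lemma diffusion_ones_eq_0: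
  assumes E: "undirected_connected_loopfree E" and card: "CARD('n::finite) \<ge> 2"
    and 0: "diffusion E ones ones (e :: real ^ 'n ^ 'n) \<le> 0"
  shows "e = 0"
proof -
  have nn: "ones \<bullet> M \<ge> 0" if "\<And>i j. M $ i $ j \<ge> 0" for M :: "real ^ 'n ^ 'n"
    using that by (simp add: inner_vec_def ones_def sum_nonneg)
  have z: "M $ i $ j = 0" if "\<And>i j. M $ i $ j \<ge> 0" "ones \<bullet> M \<le> 0" for M :: "real ^ 'n ^ 'n" and i j
  proof -
    have "(\<Sum>i\<in>UNIV. \<Sum>j\<in>UNIV. M $ i $ j) = 0"
      using nn[of M] that by (simp add: inner_vec_def ones_def)
    then show ?thesis using that(1) by (simp add: sum_nonneg_eq_0_iff sum_nonneg)
  qed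
  have "ones \<bullet> c_rate E e \<ge> 0" "ones \<bullet> d_rate E e \<ge> 0"
    by (simp_all add: nn c_rate_nonneg d_rate_nonneg)
  with 0 have "ones \<bullet> c_rate E e \<le> 0" "ones \<bullet> d_rate E e \<le> 0"
    by (simp_all add: diffusion_def)
  then have cz: "c_rate E e $ i $ j = 0" and dz: "d_rate E e $ i $ j = 0" for i j
    by (simp_all add: z c_rate_nonneg d_rate_nonneg)
  have edge: "e $ i = e $ k" if "(i, k) \<in> E" for i k
    using cz[of k i] that by (simp add: c_rate_def adj_def)
  have rows: "e $ i = e $ k" for i k
  proof -
    have "(i, k) \<in> E\<^sup>*" using E by (simp add: undirected_connected_loopfree_def)
    then show ?thesis by induction (simp_all add: edge)
  qed
  have "e $ i $ j = 0" for i j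
  proof -
    obtain l where "l \<noteq> j"
      using card by (metis (full_types) UNIV_I card_2_iff' card_le_Suc0_iff_eq finite numeral_2_eq_2 not_less_eq_eq)
    moreover have "(j, l) \<in> E\<^sup>*" using E by (simp add: undirected_connected_loopfree_def)
    ultimately obtain k where "(j, k) \<in> E" by (metis converse_rtranclE)
    then have "e $ k $ j = 0" using dz[of k j] by (simp add: d_rate_def adj_def)
    with rows[of i k] show ?thesis by simp
  qed
  then show ?thesis by (simp add: vec_eq_iff)
qed

text \<open>The constant is the minimum on the unit sphere, which is compact.\<close>
lemma homogeneous_pos_imp_coercive:
  fixes q :: "'a::euclidean_space \<Rightarrow> real"
  assumes cont: "continuous_on UNIV q" and hom: "\<And>r v. q (r *\<^sub>R v) = r\<^sup>2 * q v"
    and pos: "\<And>v. v \<noteq> 0 \<Longrightarrow> q v > 0"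
  shows "\<exists>\<mu>>0. \<forall>v. \<mu> * (norm v)\<^sup>2 \<le> q v"
proof -
  obtain u where u: "u \<in> sphere 0 1" "\<And>v. v \<in> sphere 0 1 \<Longrightarrow> q u \<le> q v"
    using continuous_attains_inf[OF compact_sphere _ continuous_on_subset[OF cont subset_UNIV], of "0::'a" 1]
    by auto
  have "q u * (norm v)\<^sup>2 \<le> q v" for v
  proof (cases "v = 0")
    case True
    then show ?thesis using hom[of 0 v] by simp
  next
    case False
    then have "q u \<le> q (v /\<^sub>R norm v)" by (intro u) simp
    also have "\<dots> = q v / (norm v)\<^sup>2" by (simp add: hom power_inverse divide_inverse mult.commute)
    finally show ?thesis using False by (simp add: field_simps)
  qed
  moreover have "q u > 0" using u(1) by (intro pos) auto
  ultimately show ?thesis by blast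
qed

lemma diffusion_ones_coercive:
  assumes "undirected_connected_loopfree E" "CARD('n::finite) \<ge> 2"
  shows "\<exists>\<mu>>0. \<forall>e :: real ^ 'n ^ 'n. \<mu> * (norm e)\<^sup>2 \<le> diffusion E ones ones e"
proof (rule homogeneous_pos_imp_coercive)
  show "continuous_on UNIV (diffusion E ones (ones :: real ^ 'n ^ 'n))"
    unfolding diffusion_def[abs_def] c_rate_def d_rate_def by (intro continuous_intros) auto
  show "diffusion E ones ones (r *\<^sub>R e) = r\<^sup>2 * diffusion E ones ones e" for r and e :: "real ^ 'n ^ 'n"
  proof -
    have "c_rate E (r *\<^sub>R e) = r\<^sup>2 *\<^sub>R c_rate E e" "d_rate E (r *\<^sub>R e) = r\<^sup>2 *\<^sub>R d_rate E e"
      by (simp_all add: c_rate_def d_rate_def vec_eq_iff power_mult_distrib power2_eq_square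
          scaleR_diff_right[symmetric])
    then show ?thesis by (simp add: diffusion_def distrib_left)
  qed
  show "diffusion E ones ones e > 0" if "e \<noteq> 0" for e :: "real ^ 'n ^ 'n"
    using diffusion_ones_eq_0[OF assms] that by force
qed


section \<open>Dissipation by the game\<close>

text \<open>The vector of marginal costs that the players act on: player \<open>i\<close> evaluates its own partial derivative
  at its own estimate.\<close>
definition own_partials :: "('n::finite \<Rightarrow> real ^ 'n \<Rightarrow> real) \<Rightarrow> real ^ 'n ^ 'n \<Rightarrow> real ^ 'n" where
  "own_partials f y = (\<chi> i. partial i (f i) (y $ i))"

lemma own_partials_stacked: "own_partials f (stacked x) = pseudo_gradient f x"
  by (simp add: own_partials_def stacked_def pseudo_gradient_def)

lemma own_partials_lipschitz:
  assumes "L \<ge> 0" "\<And>i x z. norm (partial i (f i) x - partial i (f i) z) \<le> L * norm (x - z)"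
  shows "norm (own_partials f y - own_partials f z) \<le> L * norm (y - z)"
proof (rule power2_le_imp_le)
  have "(norm (own_partials f y - own_partials f z))\<^sup>2
      \<le> (\<Sum>i\<in>UNIV. (L * norm (y $ i - z $ i))\<^sup>2)"
    unfolding norm_sq_vec
    by (intro sum_mono) (simp add: own_partials_def assms(2)[unfolded real_norm_def]
        abs_le_square_iff[symmetric] abs_mult assms(1))
  also have "\<dots> = (L * norm (y - z))\<^sup>2"
    by (simp add: power_mult_distrib norm_sq_matrix sum_distrib_left)
  finally show "(norm (own_partials f y - own_partials f z))\<^sup>2 \<le> (L * norm (y - z))\<^sup>2" .
qed (simp add: assms(1))

lemma deviate_eq: "deviate x i s = x + (s - x $ i) *\<^sub>R axis i 1"
  by (simp add: deviate_def vec_eq_iff axis_def)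

text \<open>The first-order condition: at the equilibrium every player's cost, as a function of its own action,
  has a minimum.\<close>
lemma nash_equilibrium_imp_pseudo_gradient_eq_0:
  assumes "\<And>i. twice_continuously_differentiable (f i)" "nash_equilibrium f x"
  shows "pseudo_gradient f x = 0"
proof -
  have "partial i (f i) x = 0" for i
  proof -
    let ?h = "\<lambda>s. f i (deviate x i s)"
    have x: "deviate x i (x $ i) = x"
      by (simp add: deviate_eq)
    obtain f' where f': "(f i has_derivative blinfun_apply f') (at (deviate x i (x $ i)))"
      using assms(1)[of i] unfolding twice_continuously_differentiable_def by blast
    have "((\<lambda>s. deviate x i s) has_derivative (\<lambda>s. s *\<^sub>R axis i 1)) (at (x $ i))"
      unfolding deviate_eq by (auto intro!: derivative_eq_intros)
    from has_derivative_compose[OF this f'] obtain D where D: "(?h has_real_derivative D) (at (x $ i))"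
      using differentiable_def real_differentiable_def by blast
    have "?h (x $ i) \<le> ?h s" for s
      using assms(2) unfolding nash_equilibrium_def x by blast
    then have "D = 0"
      using DERIV_local_min[OF D zero_less_one] by blast
    with D show ?thesis
      unfolding partial_def by (simp add: DERIV_imp_deriv)
  qed
  then show ?thesis by (simp add: pseudo_gradient_def vec_eq_iff)
qed

definition energy :: "real ^ 'n::finite \<Rightarrow> real ^ 'n \<Rightarrow> real ^ 'n ^ 'n \<Rightarrow> real" where
  "energy xs x y = ((norm (x - xs))\<^sup>2 + (norm (y - stacked x))\<^sup>2) / 2"

text \<open>The weight of the first term is half of that of the second, as in \<open>diffusion\<close>, so that its derivative
  along the adaptation laws is a diffusion with gains \<open>c - C\<close> and \<open>d - D\<close>.\<close>
definition gain_deviation :: "real ^ 'n ^ 'n \<Rightarrow> real ^ 'n ^ 'n \<Rightarrow> real ^ 'n ^ 'n \<Rightarrow> real ^ 'n ^ 'n::finite \<Rightarrow> real" where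
  "gain_deviation C D c d = (norm (c - C))\<^sup>2 / 4 + (norm (d - D))\<^sup>2 / 2"

text \<open>The derivative of \<open>energy + gain_deviation\<close> along the closed loop: the actual gains have cancelled
  against the adaptation, and the reference gains remain.\<close>
definition lyapunov_rate where
  "lyapunov_rate f xs E C D x y =
     (y - stacked x) \<bullet> stacked (own_partials f y) - (x - xs) \<bullet> own_partials f y
     - diffusion E C D (y - stacked x)"

lemma energy_nonneg: "energy xs x y \<ge> 0"
  by (simp add: energy_def)

lemma gain_deviation_nonneg: "gain_deviation C D c d \<ge> 0"
  by (simp add: gain_deviation_def)

locale switched_game =
  fixes f :: "'n::finite \<Rightarrow> real ^ 'n \<Rightarrow> real" and xs :: "real ^ 'n" and L m :: real
    and G :: "nat \<Rightarrow> ('n \<times> 'n) set" and p :: nat and \<tau> :: "nat \<Rightarrow> real" and \<sigma> :: "real \<Rightarrow> nat"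
  assumes card: "CARD('n) \<ge> 2"
    and L: "L \<ge> 0" "\<And>i x z. norm (partial i (f i) x - partial i (f i) z) \<le> L * norm (x - z)"
    and m: "m > 0"
      "\<And>x z. (x - z) \<bullet> (pseudo_gradient f x - pseudo_gradient f z) \<ge> m * (norm (x - z))\<^sup>2"
    and graphs: "\<And>q. q \<in> {1..p} \<Longrightarrow> undirected_connected_loopfree (G q)"
    and switching: "switching_signal p \<tau> \<sigma>"
    and stationary: "pseudo_gradient f xs = 0"
begin

text \<open>The marginal costs differ from the pseudo-gradient at \<open>x\<close> by at most \<open>L * norm e\<close>, and from zero, which
  is their value at the equilibrium, by at most \<open>L * (norm e + n * norm (x - xs))\<close>. The first
  bound perturbs the strong monotonicity, the second controls the drift of the error caused by moving
  actions.\<close>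
lemma game_dissipation:
  defines "n \<equiv> real CARD('n)"
  defines "K \<equiv> L + n * L + n * n * L"
  shows "(y - stacked x) \<bullet> stacked (own_partials f y) - (x - xs) \<bullet> own_partials f y
     \<le> - m * (norm (x - xs))\<^sup>2 + K * (norm (x - xs) * norm (y - stacked x)) + K * (norm (y - stacked x))\<^sup>2"
proof -
  let ?q = "own_partials f y" and ?X = "norm (x - xs)" and ?Y = "norm (y - stacked x)"
  have "(x - xs) \<bullet> (pseudo_gradient f x - ?q) \<le> ?X * norm (pseudo_gradient f x - ?q)"
    by (rule norm_cauchy_schwarz)
  also have "\<dots> \<le> ?X * (L * ?Y)"
    using own_partials_lipschitz[OF L, of "stacked x" y]
    by (intro mult_left_mono) (simp_all add: own_partials_stacked norm_minus_commute)
  finally have A: "(x - xs) \<bullet> (pseudo_gradient f x - ?q) \<le> ?X * (L * ?Y)" .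
  have B: "(x - xs) \<bullet> pseudo_gradient f x \<ge> m * ?X\<^sup>2"
    using m(2)[of x xs] by (simp add: stationary)
  have "norm (y - stacked xs) \<le> ?Y + norm (stacked (x - xs) :: real ^ 'n ^ 'n)"
    using norm_triangle_ineq[of "y - stacked x" "stacked (x - xs)"] by (simp add: stacked_diff[symmetric])
  then have "norm (y - stacked xs) \<le> ?Y + n * ?X"
    using norm_stacked_le[of "x - xs"] by (simp add: n_def)
  moreover have "norm ?q \<le> L * norm (y - stacked xs)"
    using own_partials_lipschitz[OF L, of y "stacked xs"] by (simp add: own_partials_stacked stationary)
  ultimately have "norm ?q \<le> L * (?Y + n * ?X)"
    using L(1) by (meson mult_left_mono order_trans)
  then have "norm (stacked ?q :: real ^ 'n ^ 'n) \<le> n * (L * (?Y + n * ?X))"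
    using norm_stacked_le[of ?q] by (simp add: n_def) (meson mult_left_mono of_nat_0_le_iff order_trans)
  then have "?Y * norm (stacked ?q :: real ^ 'n ^ 'n) \<le> ?Y * (n * (L * (?Y + n * ?X)))"
    by (intro mult_left_mono) auto
  then have C: "(y - stacked x) \<bullet> stacked ?q \<le> ?Y * (n * (L * (?Y + n * ?X)))"
    using norm_cauchy_schwarz order_trans by blast
  have "(y - stacked x) \<bullet> stacked ?q - (x - xs) \<bullet> ?q
      \<le> ?Y * (n * (L * (?Y + n * ?X))) + ?X * (L * ?Y) - m * ?X\<^sup>2"
    using A B C by (simp add: inner_diff_right)
  also have "\<dots> = - m * ?X\<^sup>2 + (L + n * n * L) * (?X * ?Y) + n * L * ?Y\<^sup>2"
    by (simp add: power2_eq_square algebra_simps)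
  also have "\<dots> \<le> - m * ?X\<^sup>2 + K * (?X * ?Y) + K * ?Y\<^sup>2"
    using L(1) by (intro add_mono mult_right_mono) (auto simp: K_def n_def)
  finally show ?thesis .
qed

lemma uniform_coercivity:
  "\<exists>\<mu>>0. \<forall>q\<in>{1..p}. \<forall>e. \<mu> * (norm e)\<^sup>2 \<le> diffusion (G q) ones ones e"
proof -
  have "\<forall>q\<in>{1..p}. \<exists>\<mu>>0. \<forall>e. \<mu> * (norm e)\<^sup>2 \<le> diffusion (G q) ones ones e"
    using diffusion_ones_coercive[OF graphs card] by blast
  then obtain \<mu> where \<mu>: "\<forall>q\<in>{1..p}. \<mu> q > 0 \<and> (\<forall>e. \<mu> q * (norm e)\<^sup>2 \<le> diffusion (G q) ones ones e)"
    by metis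
  let ?\<mu> = "Min (insert 1 (\<mu> ` {1..p}))"
  have "?\<mu> * (norm e)\<^sup>2 \<le> diffusion (G q) ones ones e" if "q \<in> {1..p}" for q e
  proof -
    have "?\<mu> \<le> \<mu> q" using that by (intro Min_le) auto
    then have "?\<mu> * (norm e)\<^sup>2 \<le> \<mu> q * (norm e)\<^sup>2" by (rule mult_right_mono) simp
    with \<mu> that show ?thesis by (meson order_trans)
  qed
  moreover have "?\<mu> > 0" using \<mu> by simp
  ultimately show ?thesis by blast
qed

definition dissipative :: "real ^ 'n ^ 'n \<Rightarrow> real ^ 'n ^ 'n \<Rightarrow> bool" where
  "dissipative C D \<longleftrightarrow>
     (\<forall>q\<in>{1..p}. \<forall>x y. lyapunov_rate f xs (G q) C D x y \<le> - m * energy xs x y)"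

text \<open>Young's inequality moves the mixed term of \<open>game_dissipation\<close> into half of the monotonicity term
  and a multiple of \<open>(norm e)\<^sup>2\<close>. The gain threshold is chosen for the diffusion to absorb
  all multiples of \<open>(norm e)\<^sup>2\<close> and leave \<open>m / 2\<close> over.\<close>
lemma large_gains_dissipative:
  "\<exists>\<kappa>. \<forall>C D. (\<forall>i j. \<kappa> \<le> C $ i $ j \<and> \<kappa> \<le> D $ i $ j) \<longrightarrow> dissipative C D"
proof -
  define n where "n = real CARD('n)"
  define K where "K = L + n * L + n * n * L"
  obtain \<mu> where \<mu>: "\<mu> > 0" "\<And>q e. q \<in> {1..p} \<Longrightarrow> \<mu> * (norm e)\<^sup>2 \<le> diffusion (G q) ones ones e"
    using uniform_coercivity by blast
  have "K \<ge> 0" using L(1) by (simp add: K_def n_def)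
  define \<kappa> where "\<kappa> = (K + K\<^sup>2 / (2 * m) + m / 2) / \<mu>"
  have "\<kappa> \<ge> 0" using \<open>K \<ge> 0\<close> m(1) \<mu>(1) by (simp add: \<kappa>_def)
  have "lyapunov_rate f xs (G q) C D x y \<le> - m * energy xs x y"
    if CD: "\<And>i j. \<kappa> \<le> C $ i $ j" "\<And>i j. \<kappa> \<le> D $ i $ j" and q: "q \<in> {1..p}" for C D q x y
  proof -
    let ?X = "norm (x - xs)" and ?Y = "norm (y - stacked x)"
    have "(K + K\<^sup>2 / (2 * m) + m / 2) * ?Y\<^sup>2 = \<kappa> * (\<mu> * ?Y\<^sup>2)"
      using \<mu>(1) by (simp add: \<kappa>_def)
    also have "\<dots> \<le> \<kappa> * diffusion (G q) ones ones (y - stacked x)"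
      using \<mu>(2)[OF q] \<open>\<kappa> \<ge> 0\<close> by (rule mult_left_mono)
    also have "\<dots> \<le> diffusion (G q) C D (y - stacked x)"
      by (rule diffusion_ge_ones[OF CD])
    finally have diff: "(K + K\<^sup>2 / (2 * m) + m / 2) * ?Y\<^sup>2 \<le> diffusion (G q) C D (y - stacked x)" .
    have "0 \<le> (m * ?X - K * ?Y)\<^sup>2 / (2 * m)" using m(1) by simp
    also have "\<dots> = m / 2 * ?X\<^sup>2 - K * (?X * ?Y) + K\<^sup>2 / (2 * m) * ?Y\<^sup>2"
      using m(1) by (simp add: power2_eq_square field_simps)
    finally have young: "K * (?X * ?Y) \<le> m / 2 * ?X\<^sup>2 + K\<^sup>2 / (2 * m) * ?Y\<^sup>2" by simp
    have "lyapunov_rate f xs (G q) C D x y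
        \<le> - m * ?X\<^sup>2 + K * (?X * ?Y) + K * ?Y\<^sup>2 - (K + K\<^sup>2 / (2 * m) + m / 2) * ?Y\<^sup>2"
      unfolding lyapunov_rate_def using game_dissipation[of y x, folded n_def, folded K_def] diff
      by linarith
    also have "\<dots> \<le> - m * energy xs x y"
      using young by (simp add: energy_def algebra_simps)
    finally show ?thesis .
  qed
  then show ?thesis unfolding dissipative_def by blast
qed

section \<open>Solutions of the closed loop\<close>

text \<open>The components of a trajectory of tuples are determined by it.\<close>
lemma mem_trajectories_iff:
  "(\<lambda>t. (x t, y t, c t, d t)) \<in> {\<lambda>t. (x t, y t, c t, d t) | x y c d. P x y c d} \<longleftrightarrow> P x y c d"
proof -
  have "(\<lambda>t. (x t, y t, c t, d t)) = (\<lambda>t. (x' t, y' t, c' t, d' t))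
      \<longleftrightarrow> x = x' \<and> y = y' \<and> c = c' \<and> d = d'" for x' y' c' d'
    by (auto simp: fun_eq_iff)
  then show ?thesis by auto
qed

context
  fixes x :: "real \<Rightarrow> real ^ 'n" and y c d :: "real \<Rightarrow> real ^ 'n ^ 'n"
  assumes solution: "(\<lambda>t. (x t, y t, c t, d t)) \<in> closed_loop_solutions f G \<tau> \<sigma>"
begin

lemma solution_continuous: "continuous_on {0..} x" "continuous_on {0..} y"
    "continuous_on {0..} c" "continuous_on {0..} d"
  and c_initially_symmetric: "c 0 $ i $ j = c 0 $ j $ i"
  using solution unfolding closed_loop_solutions_def mem_trajectories_iff by blast+

abbreviation "err t \<equiv> y t - stacked (x t)"

lemma solution_derivatives:
  assumes "t > 0" "t \<notin> range \<tau>"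
  shows "((\<lambda>s. x s $ i) has_real_derivative - (own_partials f (y t) $ i)) (at t)" (is ?x)
    and "((\<lambda>s. err s $ i $ j) has_real_derivative
           (stacked (own_partials f (y t)) - coupling (G (\<sigma> t)) (c t) (d t) (err t)) $ i $ j) (at t)" (is ?e)
    and "((\<lambda>s. c s $ i $ j) has_real_derivative c_rate (G (\<sigma> t)) (err t) $ i $ j) (at t)" (is ?c)
    and "((\<lambda>s. d s $ i $ j) has_real_derivative d_rate (G (\<sigma> t)) (err t) $ i $ j) (at t)" (is ?d)
proof -
  obtain k where k: "t \<in> {\<tau> k<..<\<tau> (Suc k)}"
    using between_switching_times[OF switching, of t] assms by auto
  then have at: "at t within {\<tau> k..<\<tau> (Suc k)} = at t"
    by (intro at_within_open_subset[of t "{\<tau> k<..<\<tau> (Suc k)}"]) auto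
  have "t \<in> {\<tau> k..<\<tau> (Suc k)}" using k by auto
  note ode_k = solution[unfolded closed_loop_solutions_def mem_trajectories_iff, THEN conjunct2,
    THEN conjunct2, THEN conjunct2, THEN conjunct2, THEN conjunct2, rule_format, OF this]
  have ode: "((\<lambda>s. x s $ i) has_real_derivative - partial i (f i) (y t $ i)) (at t)"
     "((\<lambda>s. y s $ i $ j) has_real_derivative
             - ((\<Sum>l\<in>UNIV. adj (G (\<sigma> t)) i l * c t $ i $ l * (y t $ i $ j - y t $ l $ j))
                + adj (G (\<sigma> t)) i j * d t $ i $ j * (y t $ i $ j - x t $ j))) (at t)"
     "((\<lambda>s. c s $ i $ j) has_real_derivative
             adj (G (\<sigma> t)) i j * ((y t $ i - y t $ j) \<bullet> (y t $ i - y t $ j))) (at t)"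
     "((\<lambda>s. d s $ i $ j) has_real_derivative
             adj (G (\<sigma> t)) i j * (y t $ i $ j - x t $ j)\<^sup>2) (at t)" for i j
    using ode_k[of i j] unfolding at by blast+
  have err: "err s $ i $ j = y s $ i $ j - x s $ j" for s i j
    by (simp add: stacked_def)
  have row: "err t $ i - err t $ j = y t $ i - y t $ j" for i j
    by (simp add: stacked_def)
  show ?x using ode(1) by (simp add: own_partials_def)
  show ?c using ode(3) by (simp only: c_rate_def vec_lambda_beta row)
  show ?d using ode(4) by (simp only: d_rate_def vec_lambda_beta err)
  show ?e
    unfolding err
    by (rule DERIV_cong[OF DERIV_diff[OF ode(2)[of i j] ode(1)[of j]]])
      (simp add: coupling_def own_partials_def stacked_def)
qed

text \<open>Both gains of an undirected edge grow at the same rate, so their initial equality persists.\<close>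
lemma c_symmetric:
  assumes "t \<ge> 0"
  shows "c t $ i $ j = c t $ j $ i"
proof -
  have "c t $ i $ j - c t $ j $ i \<le> 0" for i j
  proof -
    have rate: "c_rate (G (\<sigma> s)) (err s) $ i $ j = c_rate (G (\<sigma> s)) (err s) $ j $ i" if "s \<ge> 0" for s
    proof -
      have "sym (G (\<sigma> s))"
        using graphs switching that unfolding undirected_connected_loopfree_def switching_signal_def by blast
      then have "adj (G (\<sigma> s)) i j = adj (G (\<sigma> s)) j i" by (rule adj_sym)
      then show ?thesis
        by (simp add: c_rate_def inner_diff_left inner_diff_right inner_commute)
    qed
    have "(c t $ i $ j - c t $ j $ i) - (c 0 $ i $ j - c 0 $ j $ i) \<le> 0 * (t - 0)"
    proof (rule increment_le_between_switches[OF switching, where g = "\<lambda>s. c s $ i $ j - c s $ j $ i"])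
      show "continuous_on {0..} (\<lambda>s. c s $ i $ j - c s $ j $ i)"
        by (intro continuous_intros solution_continuous)
      show "((\<lambda>s. c s $ i $ j - c s $ j $ i) has_real_derivative
          c_rate (G (\<sigma> s)) (err s) $ i $ j - c_rate (G (\<sigma> s)) (err s) $ j $ i) (at s)"
        if "0 < s" "s \<notin> range \<tau>" for s
        using that by (intro DERIV_diff solution_derivatives)
    qed (use assms rate in auto)
    then show ?thesis using c_initially_symmetric[of i j] by simp
  qed
  from this[of i j] this[of j i] show ?thesis by linarith
qed

lemma gains_mono:
  assumes "0 \<le> a" "a \<le> b"
  shows "c a $ i $ j \<le> c b $ i $ j" "d a $ i $ j \<le> d b $ i $ j"
proof -
  have "- (c b $ i $ j) - - (c a $ i $ j) \<le> 0 * (b - a)"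
  proof (rule increment_le_between_switches[OF switching assms, where g = "\<lambda>s. - (c s $ i $ j)"])
    show "continuous_on {0..} (\<lambda>s. - (c s $ i $ j))"
      by (intro continuous_intros solution_continuous)
  qed (auto intro!: DERIV_minus solution_derivatives simp: c_rate_nonneg)
  then show "c a $ i $ j \<le> c b $ i $ j" by simp
  have "- (d b $ i $ j) - - (d a $ i $ j) \<le> 0 * (b - a)"
  proof (rule increment_le_between_switches[OF switching assms, where g = "\<lambda>s. - (d s $ i $ j)"])
    show "continuous_on {0..} (\<lambda>s. - (d s $ i $ j))"
      by (intro continuous_intros solution_continuous)
  qed (auto intro!: DERIV_minus solution_derivatives simp: d_rate_nonneg)
  then show "d a $ i $ j \<le> d b $ i $ j" by simp
qed

definition lyapunov :: "real ^ 'n ^ 'n \<Rightarrow> real ^ 'n ^ 'n \<Rightarrow> real \<Rightarrow> real" where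
  "lyapunov C D t = energy xs (x t) (y t) + gain_deviation C D (c t) (d t)"

lemma lyapunov_nonneg: "lyapunov C D t \<ge> 0"
  by (simp add: lyapunov_def energy_nonneg gain_deviation_nonneg)

text \<open>The coupling contributes minus the diffusion with gains \<open>c\<close>, \<open>d\<close>, and the adaptation contributes the
  diffusion with gains \<open>c - C\<close>, \<open>d - D\<close>; their sum is minus the diffusion with gains \<open>C\<close>, \<open>D\<close>.\<close>
lemma lyapunov_derivative:
  assumes t: "t > 0" "t \<notin> range \<tau>"
  shows "(lyapunov C D has_real_derivative
    lyapunov_rate f xs (G (\<sigma> t)) C D (x t) (y t)) (at t)"
proof -
  let ?E = "G (\<sigma> t)" and ?q = "own_partials f (y t)"
  have sym: "sym ?E"
    using graphs switching t unfolding undirected_connected_loopfree_def switching_signal_def by force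
  have "((\<lambda>s. (norm (x s - xs))\<^sup>2) has_real_derivative 2 * ((x t - xs) \<bullet> (- ?q))) (at t)"
    by (rule has_real_derivative_norm_sq_vec)
      (auto intro!: derivative_eq_intros solution_derivatives t)
  moreover have "((\<lambda>s. (norm (err s))\<^sup>2) has_real_derivative
      2 * (err t \<bullet> (stacked ?q - coupling ?E (c t) (d t) (err t)))) (at t)"
    by (rule has_real_derivative_norm_sq_matrix) (rule solution_derivatives[OF t])
  moreover have "((\<lambda>s. (norm (c s - C))\<^sup>2) has_real_derivative 2 * ((c t - C) \<bullet> c_rate ?E (err t))) (at t)"
    by (rule has_real_derivative_norm_sq_matrix)
      (auto intro!: derivative_eq_intros solution_derivatives t)
  moreover have "((\<lambda>s. (norm (d s - D))\<^sup>2) has_real_derivative 2 * ((d t - D) \<bullet> d_rate ?E (err t))) (at t)"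
    by (rule has_real_derivative_norm_sq_matrix)
      (auto intro!: derivative_eq_intros solution_derivatives t)
  ultimately have "(lyapunov C D has_real_derivative
      (2 * ((x t - xs) \<bullet> (- ?q)) + 2 * (err t \<bullet> (stacked ?q - coupling ?E (c t) (d t) (err t)))) / 2
      + (2 * ((c t - C) \<bullet> c_rate ?E (err t)) / 4 + 2 * ((d t - D) \<bullet> d_rate ?E (err t)) / 2)) (at t)"
    unfolding lyapunov_def[abs_def] energy_def gain_deviation_def
    by (intro DERIV_add DERIV_cdivide)
  moreover have "err t \<bullet> coupling ?E (c t) (d t) (err t) = diffusion ?E (c t) (d t) (err t)"
    using t by (intro inner_coupling sym c_symmetric) simp
  moreover have "(c t - C) \<bullet> c_rate ?E (err t) / 2 + (d t - D) \<bullet> d_rate ?E (err t)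
      = diffusion ?E (c t) (d t) (err t) - diffusion ?E C D (err t)"
    by (subst diffusion_diff[symmetric]) (rule diffusion_def[symmetric])
  ultimately show ?thesis
    by (elim DERIV_cong) (simp add: lyapunov_rate_def inner_diff_right diff_divide_distrib)
qed

text \<open>The lower bound \<open>w\<close> serves twice: with \<open>w = 0\<close> for monotonicity, and with a positive \<open>w\<close> to exclude a
  positive limit of the energy.\<close>
lemma lyapunov_decrease:
  assumes CD: "dissipative C D" and "0 \<le> a" "a \<le> b"
    and w: "\<And>t. a < t \<Longrightarrow> w \<le> energy xs (x t) (y t)"
  shows "lyapunov C D b - lyapunov C D a \<le> - m * w * (b - a)"
proof (rule increment_le_between_switches[OF switching assms(2,3) _ lyapunov_derivative])
  show "continuous_on {0..} (lyapunov C D)"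
    unfolding lyapunov_def[abs_def] energy_def gain_deviation_def stacked_def
    by (intro continuous_intros solution_continuous) auto
  fix t assume t: "a < t" "t \<notin> range \<tau>"
  then have "\<sigma> t \<in> {1..p}"
    using switching \<open>0 \<le> a\<close> unfolding switching_signal_def by force
  then have "lyapunov_rate f xs (G (\<sigma> t)) C D (x t) (y t) \<le> - m * energy xs (x t) (y t)"
    using CD unfolding dissipative_def by blast
  also have "\<dots> \<le> - m * w" using w[OF t(1)] m(1) by simp
  finally show "lyapunov_rate f xs (G (\<sigma> t)) C D (x t) (y t) \<le> - m * w" .
qed

lemma lyapunov_antitone:
  assumes "dissipative C D" "0 \<le> a" "a \<le> b"
  shows "lyapunov C D b \<le> lyapunov C D a"
  using lyapunov_decrease[OF assms, of 0] by (simp add: energy_nonneg)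

lemma exists_dissipative: "\<exists>C D. dissipative C D"
proof -
  obtain \<kappa> where "\<forall>C D. (\<forall>i j. \<kappa> \<le> C $ i $ j \<and> \<kappa> \<le> D $ i $ j) \<longrightarrow> dissipative C D"
    using large_gains_dissipative by blast
  then have "dissipative (\<chi> i j. \<kappa>) (\<chi> i j. \<kappa>)" by simp
  then show ?thesis by blast
qed

lemma gains_converge:
  "\<exists>l. ((\<lambda>t. c t $ i $ j) \<longlongrightarrow> l) at_top" "\<exists>l. ((\<lambda>t. d t $ i $ j) \<longlongrightarrow> l) at_top"
proof -
  obtain C D where CD: "dissipative C D" using exists_dissipative by blast
  have V: "lyapunov C D t \<le> lyapunov C D 0" if "t \<ge> 0" for t
    using lyapunov_antitone[OF CD order_refl that] .
  have gd: "(norm (c t - C))\<^sup>2 / 4 + (norm (d t - D))\<^sup>2 / 2 \<le> lyapunov C D 0" if "t \<ge> 0" for t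
    using V[OF that] energy_nonneg[of xs "x t" "y t"] unfolding lyapunov_def[of _ _ t] gain_deviation_def by linarith
  have "\<exists>l. ((\<lambda>t. - (c t $ i $ j)) \<longlongrightarrow> l) at_top"
  proof (rule antitone_bounded_below_tendsto)
    show "- (C $ i $ j + 4 * lyapunov C D 0 + 1) \<le> - (c t $ i $ j)" if "0 \<le> t" for t
      using gd[OF that] entry_le_norm_sq[of "c t - C" i j] by (simp add: field_simps) (smt (verit) zero_le_power2)
  qed (use gains_mono in auto)
  then show "\<exists>l. ((\<lambda>t. c t $ i $ j) \<longlongrightarrow> l) at_top"
    using tendsto_minus_cancel_left by blast
  have "\<exists>l. ((\<lambda>t. - (d t $ i $ j)) \<longlongrightarrow> l) at_top"
  proof (rule antitone_bounded_below_tendsto)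
    show "- (D $ i $ j + 2 * lyapunov C D 0 + 1) \<le> - (d t $ i $ j)" if "0 \<le> t" for t
      using gd[OF that] entry_le_norm_sq[of "d t - D" i j] by (simp add: field_simps) (smt (verit) zero_le_power2)
  qed (use gains_mono in auto)
  then show "\<exists>l. ((\<lambda>t. d t $ i $ j) \<longlongrightarrow> l) at_top"
    using tendsto_minus_cancel_left by blast
qed

text \<open>The energy is the difference of the convergent functions \<open>lyapunov C D\<close> and \<open>gain_deviation\<close>. If
  its limit \<open>w\<close> were positive, \<open>lyapunov C D\<close> would eventually lose at least \<open>m * w / 2\<close> per unit of time.\<close>
lemma energy_tendsto_0: "((\<lambda>t. energy xs (x t) (y t)) \<longlongrightarrow> 0) at_top"
proof -
  obtain C D where CD: "dissipative C D" using exists_dissipative by blast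
  obtain v where v: "(lyapunov C D \<longlongrightarrow> v) at_top"
    using antitone_bounded_below_tendsto[of "lyapunov C D" 0] lyapunov_antitone[OF CD] lyapunov_nonneg by blast
  obtain lc ld where lim: "\<And>i j. ((\<lambda>t. c t $ i $ j) \<longlongrightarrow> lc i j) at_top"
      "\<And>i j. ((\<lambda>t. d t $ i $ j) \<longlongrightarrow> ld i j) at_top"
    using gains_converge by metis
  have "(c \<longlongrightarrow> (\<chi> i j. lc i j)) at_top" "(d \<longlongrightarrow> (\<chi> i j. ld i j)) at_top"
    by (intro vec_tendstoI; simp add: lim)+
  then have "((\<lambda>t. gain_deviation C D (c t) (d t)) \<longlongrightarrow> gain_deviation C D (\<chi> i j. lc i j) (\<chi> i j. ld i j)) at_top"
    unfolding gain_deviation_def by (intro tendsto_intros) auto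
  from tendsto_diff[OF v this] obtain w where w: "((\<lambda>t. energy xs (x t) (y t)) \<longlongrightarrow> w) at_top"
    by (auto simp: lyapunov_def)
  have "w \<ge> 0"
    using tendsto_lowerbound[OF w] by (simp add: energy_nonneg)
  moreover have "\<not> w > 0"
  proof
    assume "w > 0"
    then have "\<forall>\<^sub>F t in at_top. w / 2 < energy xs (x t) (y t)"
      using order_tendstoD(1)[OF w, of "w / 2"] by simp
    then obtain a where a: "a \<ge> 0" "\<And>t. t \<ge> a \<Longrightarrow> w / 2 < energy xs (x t) (y t)"
      unfolding eventually_at_top_linorder by (metis max.bounded_iff max.cobounded2)
    define M where "M = m * (w / 2)"
    have M: "M > 0" using m(1) \<open>w > 0\<close> by (simp add: M_def)
    \<comment> \<open>By time \<open>b\<close> the loss exceeds the value at time \<open>a\<close> by one.\<close>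
    define b where "b = a + (lyapunov C D a + 1) / M"
    have "lyapunov C D b - lyapunov C D a \<le> - m * (w / 2) * (b - a)"
    proof (rule lyapunov_decrease[OF CD a(1)])
      show "a \<le> b" using M lyapunov_nonneg[of C D a] by (simp add: b_def)
      show "w / 2 \<le> energy xs (x t) (y t)" if "a < t" for t
        using a(2)[of t] that by simp
    qed
    also have "\<dots> = - (M * (b - a))" by (simp add: M_def)
    also have "\<dots> = - (lyapunov C D a + 1)" using M by (simp add: b_def)
    finally show False using lyapunov_nonneg[of C D b] by simp
  qed
  ultimately show ?thesis using w by simp
qed

lemma actions_tendsto: "(x \<longlongrightarrow> xs) at_top"
  and errors_tendsto_0: "((\<lambda>t. norm (err t)) \<longlongrightarrow> 0) at_top"
proof -
  have E: "((\<lambda>t. 2 * energy xs (x t) (y t)) \<longlongrightarrow> 0) at_top"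
    using tendsto_mult_right_zero[OF energy_tendsto_0] .
  have "((\<lambda>t. (norm (x t - xs))\<^sup>2) \<longlongrightarrow> 0) at_top"
    by (rule real_tendsto_sandwich[OF _ _ tendsto_const E]) (simp_all add: energy_def)
  then show "(x \<longlongrightarrow> xs) at_top"
    by (simp add: LIM_zero_iff tendsto_norm_zero_iff)
  have "((\<lambda>t. (norm (err t))\<^sup>2) \<longlongrightarrow> 0) at_top"
    by (rule real_tendsto_sandwich[OF _ _ tendsto_const E]) (simp_all add: energy_def)
  then show "((\<lambda>t. norm (err t)) \<longlongrightarrow> 0) at_top" by simp
qed

text \<open>The two expressions differ essentially in that the distance compares the estimates with the
  equilibrium and the Lyapunov function compares them with the current actions. The constant
  grows with the number of players because \<open>stacked\<close> multiplies squared norms by it.\<close>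
lemma lyapunov_equiv_dist:
  defines "K \<equiv> 4 + 4 * real CARD('n)"
  shows "(dist (x t, y t, c t, d t) (xs, stacked xs, C, D))\<^sup>2 \<le> K * lyapunov C D t"
    and "lyapunov C D t \<le> K * (dist (x t, y t, c t, d t) (xs, stacked xs, C, D))\<^sup>2"
proof -
  let ?n = "real CARD('n)"
  let ?X = "(norm (x t - xs))\<^sup>2" and ?Y = "(norm (y t - stacked xs))\<^sup>2" and ?e = "(norm (err t))\<^sup>2"
    and ?c = "(norm (c t - C))\<^sup>2" and ?d = "(norm (d t - D))\<^sup>2"
  have dist: "(dist (x t, y t, c t, d t) (xs, stacked xs, C, D))\<^sup>2 = ?X + (?Y + (?c + ?d))"
    by (simp add: dist_norm norm_Pair)
  have par: "(norm (u + v))\<^sup>2 \<le> 2 * (norm u)\<^sup>2 + 2 * (norm v)\<^sup>2" for u v :: "real ^ 'n ^ 'n"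
    using zero_le_power2[of "norm (u - v)"]
    by (simp add: power2_norm_eq_inner inner_add_left inner_add_right inner_diff_left inner_diff_right inner_commute)
  have "?Y \<le> 2 * ?e + 2 * (?n * ?X)"
    using par[of "err t" "stacked (x t - xs)"] by (simp add: stacked_diff[symmetric] norm_sq_stacked[symmetric])
  moreover have "?e \<le> 2 * ?Y + 2 * (?n * ?X)"
    using par[of "y t - stacked xs" "stacked (xs - x t)"]
    by (simp add: stacked_diff[symmetric] norm_sq_stacked[symmetric] norm_minus_commute)
  moreover have "K * lyapunov C D t = 2 * ?X + 2 * ?e + ?c + 2 * ?d
      + 2 * (?n * ?X) + 2 * (?n * ?e) + ?n * ?c + 2 * (?n * ?d)"
    by (simp add: lyapunov_def energy_def gain_deviation_def K_def field_simps)
  moreover have "K * (?X + (?Y + (?c + ?d))) = 4 * ?X + 4 * ?Y + 4 * ?c + 4 * ?d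
      + 4 * (?n * ?X) + 4 * (?n * ?Y) + 4 * (?n * ?c) + 4 * (?n * ?d)"
    by (simp add: K_def algebra_simps)
  moreover have "lyapunov C D t = ?X / 2 + ?e / 2 + ?c / 4 + ?d / 2"
    by (simp add: lyapunov_def energy_def gain_deviation_def add_divide_distrib)
  moreover have "0 \<le> ?n * ?X" "0 \<le> ?n * ?Y" "0 \<le> ?n * ?e" "0 \<le> ?n * ?c" "0 \<le> ?n * ?d"
    "0 \<le> ?X" "0 \<le> ?Y" "0 \<le> ?e" "0 \<le> ?c" "0 \<le> ?d" by simp_all
  ultimately show "(dist (x t, y t, c t, d t) (xs, stacked xs, C, D))\<^sup>2 \<le> K * lyapunov C D t"
    and "lyapunov C D t \<le> K * (dist (x t, y t, c t, d t) (xs, stacked xs, C, D))\<^sup>2"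
    unfolding dist by linarith+
qed

end

text \<open>The reference gains are those of the equilibrium itself, so that the Lyapunov function vanishes
  there.\<close>
lemma lyapunov_stable_equilibrium:
  assumes CD: "dissipative C D"
  shows "lyapunov_stable (closed_loop_solutions f G \<tau> \<sigma>) (xs, stacked xs, C, D)"
  unfolding lyapunov_stable_def
proof (intro allI impI)
  fix \<epsilon> :: real assume "\<epsilon> > 0"
  define K where "K = 4 + 4 * real CARD('n)"
  have K: "K > 0" by (simp add: K_def)
  let ?e = "(xs, stacked xs, C, D)"
  have "dist (z t) ?e < \<epsilon>"
    if z: "z \<in> closed_loop_solutions f G \<tau> \<sigma>" "dist (z 0) ?e < \<epsilon> / K" and t: "t \<ge> 0" for z t
  proof -
    obtain x y c d where zeq: "z = (\<lambda>t. (x t, y t, c t, d t))"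
      using z(1) unfolding closed_loop_solutions_def by blast
    note sol = z(1)[unfolded zeq]
    note bounds = lyapunov_equiv_dist[OF sol, folded K_def]
    have "(dist (z t) ?e)\<^sup>2 \<le> K * lyapunov x y c d C D t"
      using bounds(1) by (simp add: zeq)
    also have "\<dots> \<le> K * lyapunov x y c d C D 0"
      using lyapunov_antitone[OF sol CD order_refl t] K by simp
    also have "\<dots> \<le> K * (K * (dist (z 0) ?e)\<^sup>2)"
      using bounds(2) K by (simp add: zeq)
    also have "\<dots> = (K * dist (z 0) ?e)\<^sup>2" by (simp add: power2_eq_square)
    finally have "dist (z t) ?e \<le> K * dist (z 0) ?e"
      by (rule power2_le_imp_le) (use K in simp)
    also have "\<dots> < \<epsilon>" using z(2) K by (simp add: field_simps)
    finally show ?thesis .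
  qed
  then show "\<exists>\<delta>>0. \<forall>z\<in>closed_loop_solutions f G \<tau> \<sigma>. dist (z 0) ?e < \<delta> \<longrightarrow> (\<forall>t\<ge>0. dist (z t) ?e < \<epsilon>)"
    using divide_pos_pos[OF \<open>\<epsilon> > 0\<close> K] by (intro exI[of _ "\<epsilon> / K"] conjI ballI impI allI)
qed

lemma equilibrium_globally_asymptotically_stable:
  "nash_globally_asymptotically_stable (closed_loop_solutions f G \<tau> \<sigma>) xs"
proof -
  have "((\<lambda>t. fst (z t)) \<longlongrightarrow> xs) at_top" if z: "z \<in> closed_loop_solutions f G \<tau> \<sigma>" for z
  proof -
    obtain x y c d where zeq: "z = (\<lambda>t. (x t, y t, c t, d t))"
      using z unfolding closed_loop_solutions_def by blast
    show ?thesis using actions_tendsto[OF z[unfolded zeq]] by (simp add: zeq)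
  qed
  then show ?thesis
    unfolding nash_globally_asymptotically_stable_def
    using large_gains_dissipative lyapunov_stable_equilibrium by metis
qed

end

theorem theorem3:
  fixes f :: "'n::finite \<Rightarrow> real ^ 'n \<Rightarrow> real"
    and G :: "nat \<Rightarrow> ('n \<times> 'n) set"
    and p :: nat and \<tau> :: "nat \<Rightarrow> real" and \<sigma> :: "real \<Rightarrow> nat"
    and xs :: "real ^ 'n"
  assumes "CARD('n) \<ge> 2"
    and "\<forall>i. twice_continuously_differentiable (f i)"
    and "\<forall>i. \<exists>l>0. \<forall>x z. norm (partial i (f i) x - partial i (f i) z) \<le> l * norm (x - z)"
    and "\<exists>m>0. \<forall>x z. (x - z) \<bullet> (pseudo_gradient f x - pseudo_gradient f z) \<ge> m * (norm (x - z))\<^sup>2"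
    and "\<forall>q\<in>{1..p}. undirected_connected_loopfree (G q)"
    and "switching_signal p \<tau> \<sigma>"
    and "nash_equilibrium f xs"
  shows "nash_globally_asymptotically_stable (closed_loop_solutions f G \<tau> \<sigma>) xs \<and>
    (\<forall>x y c d. (\<lambda>t. (x t, y t, c t, d t)) \<in> closed_loop_solutions f G \<tau> \<sigma> \<longrightarrow>
       ((\<lambda>t. norm (y t - stacked (x t))) \<longlongrightarrow> 0) at_top \<and>
       (\<forall>i j. (\<exists>L. ((\<lambda>t. c t $ i $ j) \<longlongrightarrow> L) at_top) \<and> (\<exists>L. ((\<lambda>t. d t $ i $ j) \<longlongrightarrow> L) at_top)))"
proof -
  obtain l where l: "\<And>i. l i > 0"
    "\<And>i x z. norm (partial i (f i) x - partial i (f i) z) \<le> l i * norm (x - z)"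
    using choice[OF assms(3)] by blast
  obtain m where m: "m > 0"
    "\<And>x z. (x - z) \<bullet> (pseudo_gradient f x - pseudo_gradient f z) \<ge> m * (norm (x - z))\<^sup>2"
    using assms(4) by blast
  (* The sum of the Lipschitz constants is a Lipschitz constant common to all players. *)
  interpret switched_game f xs "\<Sum>i\<in>UNIV. l i" m G p \<tau> \<sigma>
  proof
    show "(\<Sum>i\<in>UNIV. l i) \<ge> 0"
      using l(1) by (intro sum_nonneg) (auto simp: less_imp_le)
    show "norm (partial i (f i) x - partial i (f i) z) \<le> (\<Sum>i\<in>UNIV. l i) * norm (x - z)" for i x z
    proof -
      have "l i \<le> (\<Sum>i\<in>UNIV. l i)"
        using l(1) by (intro member_le_sum) (auto simp: less_imp_le)
      then have "l i * norm (x - z) \<le> (\<Sum>i\<in>UNIV. l i) * norm (x - z)"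
        by (rule mult_right_mono) simp
      with l(2)[of i x z] show ?thesis by linarith
    qed
    show "pseudo_gradient f xs = 0"
      using assms(2,7) by (intro nash_equilibrium_imp_pseudo_gradient_eq_0) auto
    show "undirected_connected_loopfree (G q)" if "q \<in> {1..p}" for q
      using assms(5) that by blast
  qed (fact assms m)+
  show ?thesis
    using equilibrium_globally_asymptotically_stable
    by (intro conjI allI impI) (assumption | rule errors_tendsto_0 gains_converge)+
qed

end
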